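(* Let $G=\langle S\mid R\rangle$ be a group with a symmetric triangular presentation and fix $\varepsilon\ge0$. Let $\rho:S\to\mathrm{GL}(W)$ be a function, where $W$ is a finite-dimensional vector space over a field $\mathbb F$. Suppose that (a) $d_{\mathrm{rk}}(\rho(s),\rho(s'))\ge1-\varepsilon/18$ for all distinct $s,s'\in S$; (b) if $s,s',s''\in S$ (not necessarily distinct) satisfy $s''s's\neq e$ in $G$, then $d_{\mathrm{rk}}(\rho(s'')\rho(s')\rho(s),\mathrm{id}_W)\ge1-\varepsilon/18$; (c) if $s,s',s''\in S$ satisfy $s''s's=e$ in $G$, then $d_{\mathrm{rk}}(\rho(s'')\rho(s')\rho(s),\mathrm{id}_W)\le\varepsilon/18$, and moreover $d_{\mathrm{rk}}(\rho(e),\mathrm{id}_W)\le\varepsilon/18$; (d) for all $s,s',s''\in S$, if $s''s's=e$ holds in $G$ then $s''s's$ is a relator in $R$. Then the generalized Dowling geometry of $\langle S\mid R\rangle$ has an $\varepsilon$-approximate vector space representation over $\mathbb F$.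
   Context: For $f,g\in\mathrm{End}(W)$, $d_{\mathrm{rk}}(f,g)=\frac{1}{\dim W}\mathrm{rk}(f-g)$. A presentation $\langle S\mid R\rangle$ is symmetric triangular if: $S,R$ finite, $e\in S$; for $e\neq s\in S$ a formal inverse $s^{-1}\in S$ with $ss^{-1}e\in R$; all relators are length-three words in $S$; if $abc\in R$ then $bca,cab,c^{-1}b^{-1}a^{-1}\in R$; $eee\in R$. Its generalized Dowling geometry is the simple rank-3 matroid on $E=\{b_1,b_2,b_3\}\cup\{s_i:s\in S,1\le i\le3\}$ in which a 3-element subset is dependent iff it lies in one of $\{b_1,b_2\}\cup\{s_1\}_{s\in S}$, $\{b_2,b_3\}\cup\{s_2\}_{s\in S}$, $\{b_3,b_1\}\cup\{s_3\}_{s\in S}$, or $\{s_i,s'_j,s''_k\}$ for a relator $s''s's\in R$ and a cyclic shift $(i,j,k)$ of $(1,2,3)$; sets of size $\le2$ are independent. For linear maps $T_e:V\to W_e$ and $A\subseteq E$, $T_A:V\to\bigoplus_{e\in A}W_e$, $v\mapsto(T_e(v))_{e\in A}$. An $\varepsilon$-approximate vector space representation of a matroid on $E$ consists of $c\in\mathbb N$, a finite-dimensional vector space $V$, spaces $W_e$ of dimension $c$ and surjective linear maps $T_e:V\to W_e$ such that (1) for every independent $A\subseteq E$, $\mathrm{rk}(T_A)\ge c(|A|-\varepsilon)$; (2) for every circuit $C$ and $x\in C$ there is a linear map $S:\bigoplus_{e\in C\setminus\{x\}}W_e\to W_x$ with $\mathrm{rk}(T_x-S\circ T_{C\setminus\{x\}})\le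 c\varepsilon$. *)

theory Defs
  imports Complex_Main "HOL-Library.Function_Algebras" "HOL-Algebra.Group"
begin

definition fin_dim_space :: "('f::field \<Rightarrow> 'v::ab_group_add \<Rightarrow> 'v) \<Rightarrow> 'v set \<Rightarrow> bool" where
  "fin_dim_space scale V \<longleftrightarrow>
     vector_space scale \<and> module.subspace scale V \<and> (\<exists>B. finite B \<and> module.span scale B = V)"

definition linear_map_on ::
  "('f::field \<Rightarrow> 'v::ab_group_add \<Rightarrow> 'v) \<Rightarrow> ('f \<Rightarrow> 'w::ab_group_add \<Rightarrow> 'w) \<Rightarrow>
   'v set \<Rightarrow> 'w set \<Rightarrow> ('v \<Rightarrow> 'w) \<Rightarrow> bool" where
  "linear_map_on sV sW V W f \<longleftrightarrow>
     f ` V \<subseteq> W \<and>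
     (\<forall>x\<in>V. \<forall>y\<in>V. f (x + y) = f x + f y) \<and>
     (\<forall>r. \<forall>x\<in>V. f (sV r x) = sW r (f x))"

definition rk :: "('f::field \<Rightarrow> 'w::ab_group_add \<Rightarrow> 'w) \<Rightarrow> 'v set \<Rightarrow> ('v \<Rightarrow> 'w) \<Rightarrow> nat" where
  "rk sW V f = vector_space.dim sW (f ` V)"

definition general_linear :: "('f::field \<Rightarrow> 'w::ab_group_add \<Rightarrow> 'w) \<Rightarrow> ('w \<Rightarrow> 'w) set" where
  "general_linear scale = {f. Vector_Spaces.linear scale scale f \<and> bij f}"

definition d_rk :: "('f::field \<Rightarrow> 'w::ab_group_add \<Rightarrow> 'w) \<Rightarrow> ('w \<Rightarrow> 'w) \<Rightarrow> ('w \<Rightarrow> 'w) \<Rightarrow> real" where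
  "d_rk scale f g =
     real (rk scale UNIV (\<lambda>x. f x - g x)) / real (vector_space.dim scale UNIV)"

definition fun_scale :: "('f \<Rightarrow> 'w \<Rightarrow> 'w) \<Rightarrow> 'f \<Rightarrow> ('i \<Rightarrow> 'w) \<Rightarrow> 'i \<Rightarrow> 'w" where
  "fun_scale scale r u = (\<lambda>i. scale r (u i))"

text \<open>The direct sum of the \<open>W i\<close> over \<open>i \<in> A\<close> (used for finite \<open>A\<close> only): families vanishing
  outside \<open>A\<close>, with pointwise operations.\<close>

definition direct_sum :: "'i set \<Rightarrow> ('i \<Rightarrow> 'w::zero set) \<Rightarrow> ('i \<Rightarrow> 'w) set" where
  "direct_sum A W = {u. (\<forall>i\<in>A. u i \<in> W i) \<and> (\<forall>i. i \<notin> A \<longrightarrow> u i = 0)}"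

definition joint_map :: "('i \<Rightarrow> 'v \<Rightarrow> 'w::zero) \<Rightarrow> 'i set \<Rightarrow> 'v \<Rightarrow> 'i \<Rightarrow> 'w" where
  "joint_map T A v = (\<lambda>i. if i \<in> A then T i v else 0)"


text \<open>A matroid is given by its ground set and its independence predicate.\<close>

definition circuit :: "'e set \<Rightarrow> ('e set \<Rightarrow> bool) \<Rightarrow> 'e set \<Rightarrow> bool" where
  "circuit E indep C \<longleftrightarrow> C \<subseteq> E \<and> \<not> indep C \<and> (\<forall>D. D \<subset> C \<longrightarrow> indep D)"

text \<open>The condition \<open>c > 0\<close> is essential: for \<open>c = 0\<close> all requirements hold vacuously.\<close>

definition approx_representation ::
  "('f::field \<Rightarrow> 'v::ab_group_add \<Rightarrow> 'v) \<Rightarrow> ('f \<Rightarrow> 'w::ab_group_add \<Rightarrow> 'w) \<Rightarrow>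
   'e set \<Rightarrow> ('e set \<Rightarrow> bool) \<Rightarrow> real \<Rightarrow>
   nat \<Rightarrow> 'v set \<Rightarrow> ('e \<Rightarrow> 'w set) \<Rightarrow> ('e \<Rightarrow> 'v \<Rightarrow> 'w) \<Rightarrow> bool" where
  "approx_representation sV sW E indep \<epsilon> c V W T \<longleftrightarrow>
     c > 0 \<and>
     fin_dim_space sV V \<and>
     (\<forall>x\<in>E. fin_dim_space sW (W x) \<and> vector_space.dim sW (W x) = c) \<and>
     (\<forall>x\<in>E. linear_map_on sV sW V (W x) (T x) \<and> T x ` V = W x) \<and>
     (\<forall>A. A \<subseteq> E \<and> indep A \<longrightarrow>
        real (rk (fun_scale sW) V (joint_map T A)) \<ge> real c * (real (card A) - \<epsilon>)) \<and>
     (\<forall>C x. circuit E indep C \<and> x \<in> C \<longrightarrow>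
        (\<exists>L. linear_map_on (fun_scale sW) sW (direct_sum (C - {x}) W) (W x) L \<and>
             real (rk sW V (\<lambda>v. T x v - L (joint_map T (C - {x}) v))) \<le> real c * \<epsilon>))"

text \<open>Types cannot be quantified existentially, so the spaces \<open>V\<close> and \<open>W x\<close> range over the
  finite-dimensional subspaces of the space of sequences over the field; up to isomorphism these
  are all finite-dimensional vector spaces.\<close>

definition has_approx_representation ::
  "'f::field itself \<Rightarrow> 'e set \<Rightarrow> ('e set \<Rightarrow> bool) \<Rightarrow> real \<Rightarrow> bool" where
  "has_approx_representation _ E indep \<epsilon> \<longleftrightarrow>
     (\<exists>c (V :: (nat \<Rightarrow> 'f) set) (W :: 'e \<Rightarrow> (nat \<Rightarrow> 'f) set) T.
        approx_representation (fun_scale (*)) (fun_scale (*)) E indep \<epsilon> c V W T)"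


text \<open>The letter \<open>(s, True)\<close> is the generator \<open>s\<close> and \<open>(s, False)\<close> is its inverse.\<close>

abbreviation group_words :: "'s set \<Rightarrow> ('s \<times> bool) list set" where
  "group_words S \<equiv> {w. fst ` set w \<subseteq> S}"

definition positive_word :: "'s list \<Rightarrow> ('s \<times> bool) list" where
  "positive_word w = map (\<lambda>s. (s, True)) w"

inductive word_equiv ::
  "'s set \<Rightarrow> ('s \<times> bool) list set \<Rightarrow> ('s \<times> bool) list \<Rightarrow> ('s \<times> bool) list \<Rightarrow> bool"
  for S R where
  refl: "u \<in> group_words S \<Longrightarrow> word_equiv S R u u"
| sym: "word_equiv S R u v \<Longrightarrow> word_equiv S R v u"
| trans: "word_equiv S R u v \<Longrightarrow> word_equiv S R v w \<Longrightarrow> word_equiv S R u w"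
| cancel: "u \<in> group_words S \<Longrightarrow> v \<in> group_words S \<Longrightarrow> s \<in> S \<Longrightarrow>
    word_equiv S R (u @ [(s, b), (s, \<not> b)] @ v) (u @ v)"
| relator: "u \<in> group_words S \<Longrightarrow> v \<in> group_words S \<Longrightarrow> r \<in> R \<Longrightarrow> r \<in> group_words S \<Longrightarrow>
    word_equiv S R (u @ r @ v) (u @ v)"

definition word_rel :: "'s set \<Rightarrow> ('s \<times> bool) list set \<Rightarrow> (('s \<times> bool) list \<times> ('s \<times> bool) list) set" where
  "word_rel S R = {(u, v). word_equiv S R u v}"

definition presented_group :: "'s set \<Rightarrow> ('s \<times> bool) list set \<Rightarrow> ('s \<times> bool) list set monoid" where
  "presented_group S R =
     \<lparr>carrier = group_words S // word_rel S R,
      mult = (\<lambda>A B. \<Union>u\<in>A. \<Union>v\<in>B. word_rel S R `` {u @ v}),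
      one = word_rel S R `` {[]}\<rparr>"

definition presented_gen :: "'s set \<Rightarrow> ('s \<times> bool) list set \<Rightarrow> 's \<Rightarrow> ('s \<times> bool) list set" where
  "presented_gen S R s = word_rel S R `` {[(s, True)]}"

lemma word_equiv_in_words:
  "word_equiv S R u v \<Longrightarrow> u \<in> group_words S \<and> v \<in> group_words S"
  by (induction rule: word_equiv.induct) auto

lemma equiv_word_rel: "equiv (group_words S) (word_rel S R)"
proof (rule equivI)
  show "word_rel S R \<subseteq> group_words S \<times> group_words S"
    using word_equiv_in_words[of S R] unfolding word_rel_def by fast
  show "refl_on (group_words S) (word_rel S R)"
    unfolding refl_on_def word_rel_def using word_equiv.refl[of _ S R] by simp
  show "sym (word_rel S R)"
    unfolding sym_def word_rel_def using word_equiv.sym[of S R] by simp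
  show "trans (word_rel S R)"
    unfolding trans_def word_rel_def using word_equiv.trans[of S R] by fast
qed

lemma word_equiv_context:
  assumes "word_equiv S R u v" "a \<in> group_words S" "b \<in> group_words S"
  shows "word_equiv S R (a @ u @ b) (a @ v @ b)"
  using assms
proof (induction rule: word_equiv.induct)
  case (refl u)
  then show ?case by (intro word_equiv.refl) auto
next
  case (sym u v)
  show ?case by (rule word_equiv.sym) (rule sym.IH[OF sym.prems])
next
  case (trans u v w)
  show ?case
    by (rule word_equiv.trans[OF trans.IH(1)[OF trans.prems] trans.IH(2)[OF trans.prems]])
next
  case (cancel u v s c)
  then show ?case
    using word_equiv.cancel[of "a @ u" S "v @ b" s R c] by (simp add: image_Un)
next
  case (relator u v r)
  then show ?case
    using word_equiv.relator[of "a @ u" S "v @ b" r R] by (simp add: image_Un)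
qed

lemma word_equiv_append:
  assumes "word_equiv S R u u'" "word_equiv S R v v'"
  shows "word_equiv S R (u @ v) (u' @ v')"
proof -
  note w = word_equiv_in_words[OF assms(1)] word_equiv_in_words[OF assms(2)]
  have "word_equiv S R (u @ v) (u' @ v)"
    using word_equiv_context[OF assms(1), of "[]" v] w by simp
  moreover have "word_equiv S R (u' @ v) (u' @ v')"
    using word_equiv_context[OF assms(2), of u' "[]"] w by simp
  ultimately show ?thesis by (rule word_equiv.trans)
qed

lemma presented_group_mult:
  assumes "u \<in> group_words S" "v \<in> group_words S"
  shows "word_rel S R `` {u} \<otimes>\<^bsub>presented_group S R\<^esub> word_rel S R `` {v} = word_rel S R `` {u @ v}"
proof -
  have "word_rel S R `` {u' @ v'} = word_rel S R `` {u @ v}"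
    if "word_equiv S R u u'" "word_equiv S R v v'" for u' v'
    using equiv_class_eq[OF equiv_word_rel, of "u @ v" "u' @ v'" S R] word_equiv_append[OF that]
    by (simp add: word_rel_def)
  moreover have "word_equiv S R u u" "word_equiv S R v v"
    by (rule word_equiv.refl, fact)+
  ultimately have "(\<Union>u'\<in>word_rel S R `` {u}. \<Union>v'\<in>word_rel S R `` {v}. word_rel S R `` {u' @ v'})
      = word_rel S R `` {u @ v}"
    unfolding word_rel_def by fast
  then show ?thesis
    by (simp add: presented_group_def)
qed

lemma word_equiv_inverse:
  assumes "w \<in> group_words S"
  shows "word_equiv S R (rev (map (apsnd Not) w) @ w) []"
  using assms
proof (induction w)
  case Nil
  show ?case using word_equiv.refl[of "[]" S R] by simp
next
  case (Cons x w)
  obtain s b where x: "x = (s, b)" by force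
  have w: "w \<in> group_words S" "s \<in> S" "rev (map (apsnd Not) w) \<in> group_words S"
    using Cons.prems x by (auto simp: image_image)
  have "word_equiv S R (rev (map (apsnd Not) w) @ [(s, \<not> b), (s, \<not> \<not> b)] @ w)
     (rev (map (apsnd Not) w) @ w)"
    using w by (intro word_equiv.cancel) auto
  then show ?case
    using word_equiv.trans[OF _ Cons.IH[OF w(1)]] x by simp
qed

lemma group_presented_group: "group (presented_group S R)"
proof (rule groupI)
  let ?G = "presented_group S R"
  have repr: "\<exists>u\<in>group_words S. A = word_rel S R `` {u}" if "A \<in> carrier ?G" for A
    using that by (simp add: presented_group_def quotient_def)
  have cl: "word_rel S R `` {u} \<in> carrier ?G" if "u \<in> group_words S" for u
    using that by (auto simp: presented_group_def intro: quotientI)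
  have one: "\<one>\<^bsub>?G\<^esub> = word_rel S R `` {[]}"
    by (simp add: presented_group_def)
  show "A \<otimes>\<^bsub>?G\<^esub> B \<in> carrier ?G" if "A \<in> carrier ?G" "B \<in> carrier ?G" for A B
  proof -
    from repr that obtain u v where "u \<in> group_words S" "v \<in> group_words S"
      "A = word_rel S R `` {u}" "B = word_rel S R `` {v}" by meson
    then show ?thesis using cl[of "u @ v"] by (simp add: presented_group_mult image_Un)
  qed
  show "\<one>\<^bsub>?G\<^esub> \<in> carrier ?G"
    using cl[of "[]"] by (simp add: one)
  show "A \<otimes>\<^bsub>?G\<^esub> B \<otimes>\<^bsub>?G\<^esub> C = A \<otimes>\<^bsub>?G\<^esub> (B \<otimes>\<^bsub>?G\<^esub> C)"
    if "A \<in> carrier ?G" "B \<in> carrier ?G" "C \<in> carrier ?G" for A B C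
  proof -
    from repr that obtain u v w where "u \<in> group_words S" "v \<in> group_words S" "w \<in> group_words S"
      "A = word_rel S R `` {u}" "B = word_rel S R `` {v}" "C = word_rel S R `` {w}" by meson
    then show ?thesis by (simp add: presented_group_mult image_Un)
  qed
  show "\<one>\<^bsub>?G\<^esub> \<otimes>\<^bsub>?G\<^esub> A = A" if "A \<in> carrier ?G" for A
  proof -
    from repr[OF that] obtain u where u: "u \<in> group_words S" "A = word_rel S R `` {u}" by blast
    then show ?thesis using presented_group_mult[of "[]" S u R] by (simp add: one)
  qed
  show "\<exists>B\<in>carrier ?G. B \<otimes>\<^bsub>?G\<^esub> A = \<one>\<^bsub>?G\<^esub>" if "A \<in> carrier ?G" for A
  proof -
    from repr[OF that] obtain u where u: "u \<in> group_words S" "A = word_rel S R `` {u}" by blast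
    let ?v = "rev (map (apsnd Not) u)"
    have v: "?v \<in> group_words S"
      using u(1) by (auto simp: image_image)
    have "word_rel S R `` {?v @ u} = word_rel S R `` {[]}"
      using equiv_class_eq[OF equiv_word_rel, of "?v @ u" "[]" S R] word_equiv_inverse[OF u(1), of R]
      by (simp add: word_rel_def)
    then show ?thesis
      using presented_group_mult[OF v u(1), of R] cl[OF v] unfolding one u(2) by metis
  qed
qed


text \<open>The formal inverse of \<open>e\<close> is \<open>e\<close> itself, which gives a meaning to the closure of \<open>R\<close> under
  formal inversion for relators containing \<open>e\<close>.\<close>

locale symmetric_triangular =
  fixes S :: "'s set" and R :: "'s list set" and e :: 's and sinv :: "'s \<Rightarrow> 's"
  assumes finite_gens: "finite S"
    and finite_relators: "finite R"
    and e_in: "e \<in> S"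
    and sinv_in: "s \<in> S \<Longrightarrow> sinv s \<in> S"
    and sinv_e: "sinv e = e"
    and sinv_relator: "s \<in> S \<Longrightarrow> s \<noteq> e \<Longrightarrow> [s, sinv s, e] \<in> R"
    and relator_words: "r \<in> R \<Longrightarrow> length r = 3 \<and> set r \<subseteq> S"
    and relator_rotate1: "[a, b, c] \<in> R \<Longrightarrow> [b, c, a] \<in> R"
    and relator_rotate2: "[a, b, c] \<in> R \<Longrightarrow> [c, a, b] \<in> R"
    and relator_inverse: "[a, b, c] \<in> R \<Longrightarrow> [sinv c, sinv b, sinv a] \<in> R"
    and eee_relator: "[e, e, e] \<in> R"

text \<open>The letter \<open>e\<close> denotes the identity of the group. This is not a consequence of the
  length-three relators (sending every generator to 1 always defines a homomorphism onto the
  integers modulo 3), so the one-letter word \<open>e\<close> is imposed as a relator as well.\<close>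

definition tri_relators :: "'s list set \<Rightarrow> 's \<Rightarrow> ('s \<times> bool) list set" where
  "tri_relators R e = positive_word ` insert [e] R"

definition tri_group :: "'s set \<Rightarrow> 's list set \<Rightarrow> 's \<Rightarrow> ('s \<times> bool) list set monoid" where
  "tri_group S R e = presented_group S (tri_relators R e)"

definition tri_gen :: "'s set \<Rightarrow> 's list set \<Rightarrow> 's \<Rightarrow> 's \<Rightarrow> ('s \<times> bool) list set" where
  "tri_gen S R e s = presented_gen S (tri_relators R e) s"

lemma (in symmetric_triangular) tri_gen_e: "tri_gen S R e e = \<one>\<^bsub>tri_group S R e\<^esub>"
proof -
  let ?R = "tri_relators R e"
  have "word_equiv S ?R ([] @ [(e, True)] @ []) ([] @ [])"
    using e_in by (intro word_equiv.relator) (auto simp: tri_relators_def positive_word_def)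
  then have "([(e, True)], []) \<in> word_rel S ?R"
    by (simp add: word_rel_def)
  from equiv_class_eq[OF equiv_word_rel this] show ?thesis
    by (simp add: tri_gen_def tri_group_def presented_gen_def presented_group_def)
qed


text \<open>\<open>Joint i\<close> is \<open>b\<^sub>i\<close> and \<open>Elt s i\<close> is \<open>s\<^sub>i\<close>, for \<open>i\<close> in \<open>{1,2,3}\<close>.\<close>

datatype 's dowling_point = Joint nat | Elt 's nat

definition dowling_ground :: "'s set \<Rightarrow> 's dowling_point set" where
  "dowling_ground S = Joint ` {1, 2, 3} \<union> {Elt s i | s i. s \<in> S \<and> i \<in> {1, 2, 3}}"

definition dowling_lines :: "'s set \<Rightarrow> 's list set \<Rightarrow> 's dowling_point set set" where
  "dowling_lines S R =
     {{Joint 1, Joint 2} \<union> {Elt s 1 | s. s \<in> S},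
      {Joint 2, Joint 3} \<union> {Elt s 2 | s. s \<in> S},
      {Joint 3, Joint 1} \<union> {Elt s 3 | s. s \<in> S}} \<union>
     {{Elt s i, Elt s' j, Elt s'' k} | s s' s'' i j k.
        [s'', s', s] \<in> R \<and> (i, j, k) \<in> {(1, 2, 3), (2, 3, 1), (3, 1, 2)}}"

definition dowling_indep :: "'s set \<Rightarrow> 's list set \<Rightarrow> 's dowling_point set \<Rightarrow> bool" where
  "dowling_indep S R A \<longleftrightarrow>
     A \<subseteq> dowling_ground S \<and> finite A \<and>
     (card A \<le> 2 \<or> card A = 3 \<and> \<not> (\<exists>l\<in>dowling_lines S R. A \<subseteq> l))"

end

theory Submission
  imports Defs "HOL-Analysis.Product_Vector"
begin

text \<open>On \<open>V = W\<^sup>3\<close> let \<open>b\<^sub>i\<close> act as the coordinate \<open>v\<^sub>i\<close> and \<open>s\<^sub>i\<close> as \<open>v\<^sub>i\<^sub>+\<^sub>1 - \<rho> s v\<^sub>i\<close>, with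
  indices modulo 3. For a vector killed by two points of a line \<open>{b\<^sub>i, b\<^sub>i\<^sub>+\<^sub>1, s\<^sub>i, \<dots>}\<close>, the coordinate
  \<open>v\<^sub>i\<close> determines \<open>v\<^sub>i\<^sub>+\<^sub>1\<close>; for one killed by three independent points, a single coordinate determines
  all of them. In both cases this coordinate lies in the coincidence space of some
  \<open>\<rho> s\<close> and \<open>\<rho> s'\<close> with \<open>s \<noteq> s'\<close>, in the fixed space of some \<open>\<rho> s'' \<rho> s' \<rho> s\<close> with
  \<open>s'' s' s \<noteq> e\<close>, or in \<open>0\<close>. By (a), (b) and (d) these spaces have dimension at most
  \<open>\<epsilon> dim W / 18\<close>. On the common kernel of two points of a relator line the third map is
  \<open>w - \<rho> s'' \<rho> s' \<rho> s w\<close>, which has small rank by (c). This suffices because the smallest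
  rank of \<open>T\<^sub>x - L \<circ> T\<^sub>A\<close> over all linear \<open>L\<close> is the dimension of \<open>T\<^sub>x (ker T\<^sub>A)\<close>.\<close>

section \<open>Linear algebra\<close>

lemma vector_space_fun_scale:
  assumes "vector_space s"
  shows "vector_space (fun_scale s)"
proof -
  interpret vector_space s by fact
  show ?thesis
    by unfold_locales (auto simp: fun_scale_def fun_eq_iff scale_right_distrib scale_left_distrib)
qed

lemma vector_space_field: "vector_space ((*) :: 'f::field \<Rightarrow> 'f \<Rightarrow> 'f)"
  by unfold_locales (auto simp: algebra_simps)

text \<open>The field as a space over itself stands in for \<open>W\<close> when \<open>W\<close> is
  zero.\<close>

lemma finite_dimensional_vector_space_field:
  "finite_dimensional_vector_space ((*) :: 'f::field \<Rightarrow> 'f \<Rightarrow> 'f) {1}"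
proof -
  interpret vector_space "(*) :: 'f \<Rightarrow> 'f \<Rightarrow> 'f" by (rule vector_space_field)
  have "x \<in> span {1}" for x :: 'f
    using span_scale[OF span_base[of 1 "{1}"], of x] by simp
  then show ?thesis
    by unfold_locales auto
qed

context finite_dimensional_vector_space_pair_1
begin

text \<open>The image of a basis of \<open>Y\<close> is a finite set whose span contains
  \<open>X\<close>. Counting a spanning set avoids monotonicity of \<open>dim\<close> in the target,
  which may be infinite-dimensional.\<close>

lemma dim_le_of_subset_image:
  assumes lf: "Vector_Spaces.linear s1 s2 f" and sub: "X \<subseteq> f ` Y"
  shows "vs2.dim X \<le> vs1.dim Y"
proof -
  interpret f: Vector_Spaces.linear s1 s2 f by fact
  obtain B where B: "vs1.independent B" "Y \<subseteq> vs1.span B" "card B = vs1.dim Y"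
    using vs1.basis_exists[of Y] by blast
  have fin: "finite B" using B(1) by (rule vs1.finiteI_independent)
  have "X \<subseteq> vs2.span (f ` B)"
    using sub f.spans_image[OF B(2)] by blast
  then have "vs2.dim X \<le> card (f ` B)"
    by (rule vs2.dim_le_card) (simp add: fin)
  also have "\<dots> \<le> card B" by (rule card_image_le[OF fin])
  finally show ?thesis using B(3) by simp
qed

text \<open>Along a linear right inverse \<open>h\<close> of \<open>f\<close> on \<open>U\<close>,
  every \<open>u\<close> splits as \<open>h (f u)\<close> plus an element of the kernel, so a lifted
  basis of the image together with a basis of the kernel spans \<open>U\<close>.\<close>

lemma dim_le_image_plus_kernel:
  assumes lf: "Vector_Spaces.linear s1 s2 f" and U: "vs1.subspace U"
  shows "vs1.dim U \<le> vs2.dim (f ` U) + vs1.dim {u \<in> U. f u = 0}"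
proof -
  interpret f: Vector_Spaces.linear s1 s2 f by fact
  obtain h where h: "range h \<subseteq> U" "Vector_Spaces.linear s2 s1 h" "\<forall>v\<in>f ` U. f (h v) = v"
    using linear_exists_right_inverse_on[OF lf U] by blast
  interpret h: Vector_Spaces.linear s2 s1 h by (rule h(2))
  obtain K where K: "vs1.independent K" "{u \<in> U. f u = 0} \<subseteq> vs1.span K"
      "card K = vs1.dim {u \<in> U. f u = 0}"
    using vs1.basis_exists[of "{u \<in> U. f u = 0}"] by blast
  have finK: "finite K" using K(1) by (rule vs1.finiteI_independent)
  obtain C where C: "C \<subseteq> f ` U" "vs2.independent C" "f ` U \<subseteq> vs2.span C"
      "card C = vs2.dim (f ` U)"
    using vs2.basis_exists[of "f ` U"] by blast
  \<comment> \<open>An independent set inside the span of a finite set is finite. An infinite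
    \<open>C\<close> would have \<open>card C = 0\<close> and the count below would say
    nothing.\<close>
  have "C \<subseteq> vs2.span (f ` B1)"
    using C(1) f.spans_image[of U B1] vs1.span_Basis by auto
  then have finC: "finite C"
    using vs2.independent_span_bound[OF _ C(2)] vs1.finite_Basis by blast
  have "u \<in> vs1.span (h ` C \<union> K)" if u: "u \<in> U" for u
  proof -
    have "h (f u) \<in> vs1.span (h ` C)"
      using h.spans_image[OF C(3)] u by blast
    moreover have "u - h (f u) \<in> {u \<in> U. f u = 0}"
      using u h(1,3) by (auto simp: f.diff intro!: vs1.subspace_diff[OF U])
    then have "u - h (f u) \<in> vs1.span K"
      using K(2) by blast
    ultimately have "h (f u) + (u - h (f u)) \<in> vs1.span (h ` C \<union> K)"
      by (intro vs1.span_add) (meson in_mono sup_ge1 sup_ge2 vs1.span_mono)+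
    then show ?thesis by simp
  qed
  then have "vs1.dim U \<le> card (h ` C \<union> K)"
    by (intro vs1.dim_le_card) (auto simp: finC finK)
  also have "\<dots> \<le> card C + card K"
    using card_Un_le[of "h ` C" K] card_image_le[OF finC, of h] by linarith
  finally show ?thesis using C(4) K(3) by simp
qed

text \<open>The opposite inequality, for the whole space: it turns a large rank of a difference into
  a small coincidence space. The kernel and a lifted copy \<open>U\<close> of the image meet only in
  0, so their dimensions add up.\<close>

lemma rank_plus_nullity_le:
  assumes lf: "Vector_Spaces.linear s1 s2 f"
  shows "vs2.dim (range f) + vs1.dim {v. f v = 0} \<le> card B1"
proof -
  interpret f: Vector_Spaces.linear s1 s2 f by fact
  obtain h where h: "Vector_Spaces.linear s2 s1 h" "\<forall>v\<in>range f. f (h v) = v"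
    using linear_exists_right_inverse_on[OF lf vs1.subspace_UNIV] by blast
  interpret h: Vector_Spaces.linear s2 s1 h by (rule h(1))
  define K where "K = {v. f v = 0}"
  define U where "U = h ` range f"
  have "vs1.subspace K"
    unfolding K_def by (rule f.subspace_kernel)
  moreover have "vs1.subspace U"
    unfolding U_def by (intro h.subspace_image f.subspace_image vs1.subspace_UNIV)
  ultimately have "vs1.dim {x + y |x y. x \<in> K \<and> y \<in> U} + vs1.dim (K \<inter> U) = vs1.dim K + vs1.dim U"
    by (rule vs1.dim_sums_Int)
  \<comment> \<open>If \<open>h (f x)\<close> is killed by \<open>f\<close>, then
    \<open>f x = f (h (f x)) = 0\<close>, hence \<open>h (f x) = 0\<close>.\<close>
  moreover have "K \<inter> U \<subseteq> {0}"
    using h(2) by (auto simp: K_def U_def)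
  then have "vs1.dim (K \<inter> U) = 0" by simp
  moreover have "vs2.dim (range f) \<le> vs1.dim U"
  proof (rule dim_le_of_subset_image[OF lf])
    have "f x = f (h (f x))" for x using h(2) by simp
    then show "range f \<subseteq> f ` U" unfolding U_def by blast
  qed
  moreover have "vs1.dim {x + y |x y. x \<in> K \<and> y \<in> U} \<le> card B1"
    using vs1.dim_subset[OF subset_UNIV] by simp
  ultimately show ?thesis unfolding K_def by linarith
qed

end

text \<open>The basis is numbered by natural numbers and coordinates are written at these positions,
  with 0 elsewhere. This moves abstract spaces into the sequence space over which
  \<open>has_approx_representation\<close> quantifies.\<close>

lemma (in finite_dimensional_vector_space) exists_linear_embedding_in_sequences:
  "\<exists>\<phi>. Vector_Spaces.linear scale (fun_scale (*)) \<phi> \<and> inj (\<phi> :: 'b \<Rightarrow> nat \<Rightarrow> 'a)"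
proof -
  obtain f :: "'b \<Rightarrow> nat" where f: "inj_on f Basis"
    using finite_imp_inj_to_nat_seg[OF finite_Basis] by blast
  define \<phi> :: "'b \<Rightarrow> nat \<Rightarrow> 'a"
    where "\<phi> w = (\<lambda>n. if n \<in> f ` Basis then representation Basis w (inv_into Basis f n) else 0)" for w
  have "Vector_Spaces.linear scale (fun_scale (*)) \<phi>"
    unfolding Vector_Spaces.linear_iff
    using vector_space_axioms vector_space_fun_scale[OF vector_space_field]
    by (auto simp: \<phi>_def fun_eq_iff fun_scale_def span_Basis
        representation_add[OF independent_Basis] representation_scale[OF independent_Basis])
  moreover have "inj \<phi>"
  proof (rule injI)
    fix v w assume eq: "\<phi> v = \<phi> w"
    have "representation Basis v b = representation Basis w b" if "b \<in> Basis" for b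
      using fun_cong[OF eq, of "f b"] that f by (simp add: \<phi>_def)
    then have "(\<Sum>b\<in>Basis. scale (representation Basis v b) b)
        = (\<Sum>b\<in>Basis. scale (representation Basis w b) b)"
      by simp
    then show "v = w"
      by (simp add: sum_representation_eq[OF independent_Basis _ finite_Basis] span_Basis)
  qed
  ultimately show ?thesis by blast
qed

section \<open>A kernel criterion for approximate representations\<close>

text \<open>Everything is transported to sequences along embeddings of \<open>V\<close> and
  \<open>W\<close>. Condition (1) then follows from rank and nullity of \<open>T_A\<close>, and
  condition (2) from composing \<open>T x\<close> with a linear section of the joint map.\<close>

lemma has_approx_representationI:
  fixes sV :: "'f::field \<Rightarrow> 'v::ab_group_add \<Rightarrow> 'v" and sW :: "'f \<Rightarrow> 'w::ab_group_add \<Rightarrow> 'w"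
    and T :: "'e \<Rightarrow> 'v \<Rightarrow> 'w"
  assumes V: "finite_dimensional_vector_space sV BV"
    and W: "finite_dimensional_vector_space sW BW"
    and pos: "card BW > 0"
    and lin: "\<And>x. Vector_Spaces.linear sV sW (T x)"
    and surj: "\<And>x. x \<in> E \<Longrightarrow> surj (T x)"
    and indep: "\<And>A. A \<subseteq> E \<Longrightarrow> indep A \<Longrightarrow>
      real (vector_space.dim sV {v. \<forall>x\<in>A. T x v = 0})
        \<le> real (card BV) - real (card BW) * (real (card A) - \<epsilon>)"
    and circ: "\<And>C x. circuit E indep C \<Longrightarrow> x \<in> C \<Longrightarrow>
      real (vector_space.dim sW (T x ` {v. \<forall>y\<in>C - {x}. T y v = 0})) \<le> real (card BW) * \<epsilon>"
  shows "has_approx_representation TYPE('f) E indep \<epsilon>"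
proof -
  define sQ where "sQ = (fun_scale (*) :: 'f \<Rightarrow> (nat \<Rightarrow> 'f) \<Rightarrow> nat \<Rightarrow> 'f)"
  define sJ where "sJ = (fun_scale sQ :: 'f \<Rightarrow> ('e \<Rightarrow> nat \<Rightarrow> 'f) \<Rightarrow> 'e \<Rightarrow> nat \<Rightarrow> 'f)"
  interpret V: finite_dimensional_vector_space sV BV by fact
  interpret W: finite_dimensional_vector_space sW BW by fact
  interpret Q: vector_space sQ
    unfolding sQ_def by (rule vector_space_fun_scale[OF vector_space_field])
  interpret J: vector_space sJ
    unfolding sJ_def by (rule vector_space_fun_scale[OF Q.vector_space_axioms])
  interpret VQ: finite_dimensional_vector_space_pair_1 sV BV sQ by unfold_locales
  interpret WQ: finite_dimensional_vector_space_pair_1 sW BW sQ by unfold_locales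
  interpret VJ: finite_dimensional_vector_space_pair_1 sV BV sJ by unfold_locales
  obtain \<iota> where \<iota>: "Vector_Spaces.linear sV sQ \<iota>" "inj \<iota>"
    using V.exists_linear_embedding_in_sequences unfolding sQ_def by blast
  obtain \<phi> where \<phi>: "Vector_Spaces.linear sW sQ \<phi>" "inj \<phi>"
    using W.exists_linear_embedding_in_sequences unfolding sQ_def by blast
  interpret \<iota>: Vector_Spaces.linear sV sQ \<iota> by fact
  interpret \<phi>: Vector_Spaces.linear sW sQ \<phi> by fact
  interpret T: Vector_Spaces.linear sV sW "T x" for x by (rule lin)
  \<comment> \<open>The left inverse extends the transported maps to all sequences, also outside the
    range of \<open>\<iota>\<close>.\<close>
  obtain \<kappa> where \<kappa>: "Vector_Spaces.linear sQ sV \<kappa>" "\<kappa> \<circ> \<iota> = id"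
    using VQ.linear_injective_left_inverse[OF \<iota>] by blast
  interpret \<kappa>: Vector_Spaces.linear sQ sV \<kappa> by fact
  have \<kappa>\<iota>: "\<kappa> (\<iota> v) = v" for v using \<kappa>(2) by (simp add: fun_eq_iff)
  have \<phi>0: "\<phi> w = 0 \<longleftrightarrow> w = 0" for w
    using inj_eq[OF \<phi>(2), of w 0] by simp
  define T' where "T' x = (\<lambda>u. \<phi> (T x (\<kappa> u)))" for x
  define J where "J A v = joint_map T' A (\<iota> v)" for A v
  have J_apply: "J A v = (\<lambda>x. if x \<in> A then \<phi> (T x v) else 0)" for A v
    by (simp add: J_def joint_map_def T'_def \<kappa>\<iota> fun_eq_iff)
  have linJ: "Vector_Spaces.linear sV sJ (J A)" for A
    unfolding Vector_Spaces.linear_iff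
    using V.vector_space_axioms J.vector_space_axioms
    by (auto simp: J_apply fun_eq_iff T.add \<phi>.add T.scale \<phi>.scale sJ_def fun_scale_def[of sQ])
  have kerJ: "J A v = 0 \<longleftrightarrow> (\<forall>x\<in>A. T x v = 0)" for A v
    by (auto simp: J_apply fun_eq_iff \<phi>0) (metis \<phi>0 ext zero_fun_apply)+
  have "approx_representation sQ sQ E indep \<epsilon> (card BW) (range \<iota>) (\<lambda>_. range \<phi>) T'"
    unfolding approx_representation_def sJ_def[symmetric]
  proof (intro conjI ballI allI impI)
    show "card BW > 0" by (rule pos)
    show "fin_dim_space sQ (range \<iota>)"
      unfolding fin_dim_space_def
      using \<iota>.span_image[of BV] V.finite_Basis \<iota>.subspace_image[OF V.subspace_UNIV]
      by (auto simp: V.span_Basis intro!: Q.vector_space_axioms exI[of _ "\<iota> ` BV"])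
    show "fin_dim_space sQ (range \<phi>)" for x :: 'e
      unfolding fin_dim_space_def
      using \<phi>.span_image[of BW] W.finite_Basis \<phi>.subspace_image[OF W.subspace_UNIV]
      by (auto simp: W.span_Basis intro!: Q.vector_space_axioms exI[of _ "\<phi> ` BW"])
    show "Q.dim (range \<phi>) = card BW" for x :: 'e
      using WQ.dim_image_eq[OF \<phi>(1), of UNIV] \<phi>(2) by simp
    show "linear_map_on sQ sQ (range \<iota>) (range \<phi>) (T' x)" for x
      by (auto simp: linear_map_on_def T'_def \<kappa>.add T.add \<phi>.add \<kappa>.scale T.scale \<phi>.scale)
    show "T' x ` range \<iota> = range \<phi>" if "x \<in> E" for x
    proof -
      have "T' x ` range \<iota> = \<phi> ` range (T x)"
        by (simp add: T'_def image_image \<kappa>\<iota>)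
      then show ?thesis using surj[OF that] by simp
    qed
  next
    fix A assume A: "A \<subseteq> E \<and> indep A"
    have "rk sJ (range \<iota>) (joint_map T' A) = J.dim (range (J A))"
      by (simp add: rk_def J_def[abs_def] image_image)
    moreover have "card BV \<le> J.dim (range (J A)) + V.dim {v. \<forall>x\<in>A. T x v = 0}"
      using VJ.dim_le_image_plus_kernel[OF linJ V.subspace_UNIV, of A] by (simp add: kerJ)
    ultimately show "real (card BW) * (real (card A) - \<epsilon>)
        \<le> real (rk sJ (range \<iota>) (joint_map T' A))"
      using indep[of A] A by linarith
  next
    fix C x assume C: "circuit E indep C \<and> x \<in> C"
    let ?A = "C - {x}"
    obtain h where h: "Vector_Spaces.linear sJ sV h" "\<forall>v\<in>range (J ?A). J ?A (h v) = v"
      using VJ.linear_exists_right_inverse_on[OF linJ V.subspace_UNIV] by blast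
    interpret h: Vector_Spaces.linear sJ sV h by (rule h(1))
    interpret JA: Vector_Spaces.linear sV sJ "J ?A" by (rule linJ)
    \<comment> \<open>Since \<open>h\<close> is a section of \<open>J ?A\<close>, the vector
      \<open>v - h (J ?A v)\<close> lies in the common kernel, so the error of \<open>L\<close> at
      \<open>v\<close> lies in the image of that kernel under \<open>T x\<close>.\<close>
    define L where "L u = \<phi> (T x (h u))" for u
    have "linear_map_on sJ sQ (direct_sum ?A (\<lambda>_. range \<phi>)) (range \<phi>) L"
      by (auto simp: linear_map_on_def L_def h.add T.add \<phi>.add h.scale T.scale \<phi>.scale)
    moreover have "(\<lambda>v. T' x v - L (joint_map T' ?A v)) ` range \<iota>
        \<subseteq> \<phi> ` (T x ` {v. \<forall>y\<in>?A. T y v = 0})"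
    proof
      fix u assume "u \<in> (\<lambda>v. T' x v - L (joint_map T' ?A v)) ` range \<iota>"
      then obtain v where "u = T' x (\<iota> v) - L (J ?A v)"
        by (auto simp: J_def)
      then have "u = \<phi> (T x (v - h (J ?A v)))"
        by (simp add: T'_def L_def \<kappa>\<iota> T.diff \<phi>.diff)
      moreover have "J ?A (v - h (J ?A v)) = 0"
        using h(2) by (simp add: JA.diff)
      ultimately show "u \<in> \<phi> ` (T x ` {v. \<forall>y\<in>?A. T y v = 0})"
        unfolding kerJ by blast
    qed
    then have "real (rk sQ (range \<iota>) (\<lambda>v. T' x v - L (joint_map T' ?A v))) \<le> real (card BW) * \<epsilon>"
      using WQ.dim_le_of_subset_image[OF \<phi>(1)] circ[of C x] C unfolding rk_def
      by (meson of_nat_mono order_trans)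
    ultimately show "\<exists>L. linear_map_on sJ sQ (direct_sum ?A (\<lambda>_. range \<phi>)) (range \<phi>) L \<and>
        real (rk sQ (range \<iota>) (\<lambda>v. T' x v - L (joint_map T' ?A v))) \<le> real (card BW) * \<epsilon>"
      by blast
  qed
  then show ?thesis
    unfolding has_approx_representation_def sQ_def by blast
qed

section \<open>Points and lines of the Dowling geometry\<close>

definition next_index :: "nat \<Rightarrow> nat" where
  "next_index i = i mod 3 + 1"

lemma next_index_simps [simp]:
  "next_index (Suc 0) = 2" "next_index 1 = 2" "next_index 2 = 3" "next_index 3 = 1"
  by (simp_all add: next_index_def)

lemma dowling_ground_cases:
  assumes "x \<in> dowling_ground S"
  shows "(\<exists>j\<in>{1, 2, 3}. x = Joint j) \<or> (\<exists>s\<in>S. \<exists>j\<in>{1, 2, 3}. x = Elt s j)"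
  using assms unfolding dowling_ground_def by blast

definition joint_line :: "'s set \<Rightarrow> nat \<Rightarrow> 's dowling_point set" where
  "joint_line S i = {Joint i, Joint (next_index i)} \<union> {Elt s i | s. s \<in> S}"

definition relator_line :: "'s \<Rightarrow> 's \<Rightarrow> 's \<Rightarrow> nat \<Rightarrow> 's dowling_point set" where
  "relator_line s s' s'' i =
     {Elt s i, Elt s' (next_index i), Elt s'' (next_index (next_index i))}"

text \<open>With a single cyclic index per line, rotating a relator becomes a shift of the
  index.\<close>

lemma dowling_lines_eq:
  "dowling_lines S R = joint_line S ` {1, 2, 3} \<union>
     {relator_line s s' s'' i | s s' s'' i. [s'', s', s] \<in> R \<and> i \<in> {1, 2, 3}}"
  unfolding dowling_lines_def
proof (intro arg_cong2[where f = "(\<union>)"])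
  show "{{Joint 1, Joint 2} \<union> {Elt s 1 | s. s \<in> S},
      {Joint 2, Joint 3} \<union> {Elt s 2 | s. s \<in> S},
      {Joint 3, Joint 1} \<union> {Elt s 3 | s. s \<in> S}} = joint_line S ` {1, 2, 3}"
    by (simp add: joint_line_def)
  show "{{Elt s i, Elt s' j, Elt s'' k} | s s' s'' i j k.
        [s'', s', s] \<in> R \<and> (i, j, k) \<in> {(1, 2, 3), (2, 3, 1), (3, 1, 2)}} =
      {relator_line s s' s'' i | s s' s'' i. [s'', s', s] \<in> R \<and> i \<in> {1, 2, 3}}"
  proof -
    have "(i, j, k) \<in> {(1, 2, 3), (2, 3, 1), (3, 1, 2)} \<longleftrightarrow>
        i \<in> {1, 2, 3} \<and> j = next_index i \<and> k = next_index (next_index i)" for i j k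
      by (auto simp: next_index_def)
    note index_triples = this
    show ?thesis
      unfolding relator_line_def index_triples
      by (simp del: insert_iff)
  qed
qed

text \<open>A point \<open>Elt s a\<close> fixes the index of its line. Otherwise both points are
  joints, and the pairs of joints on different lines differ.\<close>

lemma two_joint_lines_meet_once:
  assumes "i \<in> {1, 2, 3}" "j \<in> {1, 2, 3}" "y \<noteq> z"
    and "y \<in> joint_line S i" "z \<in> joint_line S i" "y \<in> joint_line S j" "z \<in> joint_line S j"
  shows "i = j"
proof -
  have Joint_iff: "Joint a \<in> joint_line S l \<longleftrightarrow> a = l \<or> a = next_index l"
    and Elt_iff: "Elt s a \<in> joint_line S l \<longleftrightarrow> s \<in> S \<and> a = l" for s a l
    by (auto simp: joint_line_def)
  show ?thesis
  proof (cases y)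
    case (Elt s a)
    then show ?thesis using assms(4,6) by (simp add: Elt_iff)
  next
    case y: (Joint a)
    show ?thesis
    proof (cases z)
      case (Elt s b)
      then show ?thesis using assms(5,7) by (simp add: Elt_iff)
    next
      case z: (Joint b)
      have "a \<noteq> b" "a = i \<or> a = next_index i" "b = i \<or> b = next_index i"
          "a = j \<or> a = next_index j" "b = j \<or> b = next_index j"
        using assms(3-7) y z by (simp_all add: Joint_iff)
      then have "{i, next_index i} = {j, next_index j}" by auto
      then show ?thesis
        using assms(1,2) by (auto simp: doubleton_eq_iff)
    qed
  qed
qed

text \<open>Kernel bounds for triples pass to smaller sets through this extension. The added point
  can be a joint: if none worked for a pair, all three joints would lie on the one joint line
  through that pair.\<close>

lemma dowling_indep_extend:
  assumes A: "dowling_indep S R A" and card: "card A < 3"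
  shows "\<exists>x. x \<notin> A \<and> dowling_indep S R (insert x A)"
proof (cases "card A = 2")
  case False
  have fin: "finite A" using A by (simp add: dowling_indep_def)
  have "\<exists>j\<in>{1, 2 :: nat}. Joint j \<notin> A"
  proof (rule ccontr)
    assume "\<not> ?thesis"
    then have "{Joint 1, Joint 2} \<subseteq> A" by auto
    from card_mono[OF fin this] show False using False card by simp
  qed
  then obtain j :: nat where "j \<in> {1, 2}" "Joint j \<notin> A" by blast
  then have "dowling_indep S R (insert (Joint j) A)"
    using A False card by (auto simp: dowling_indep_def dowling_ground_def)
  then show ?thesis using \<open>Joint j \<notin> A\<close> by blast
next
  case True
  then obtain y z where yz: "A = {y, z}" "y \<noteq> z" by (auto simp: card_2_iff)
  have "\<exists>j\<in>{1, 2, 3}. Joint j \<notin> A \<and> (\<forall>l\<in>dowling_lines S R. \<not> insert (Joint j) A \<subseteq> l)"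
  proof (rule ccontr)
    assume neg: "\<not> ?thesis"
    have on_line: "\<exists>i\<in>{1, 2, 3}. insert (Joint j) A \<subseteq> joint_line S i" if j: "j \<in> {1, 2, 3}" for j
    proof (cases "Joint j \<in> A")
      case False
      then obtain l where l: "l \<in> dowling_lines S R" "insert (Joint j) A \<subseteq> l"
        using neg j by blast
      then show ?thesis
        by (auto simp: dowling_lines_eq relator_line_def)
    next
      case True
      then obtain q where q: "A = {Joint j, q}" using yz by auto
      \<comment> \<open>A joint outside \<open>A\<close>. A line through it and \<open>A\<close>
        contains a joint, hence is a joint line, and it already contains \<open>Joint j\<close>
        because \<open>A\<close> does.\<close>
      define j' where
        "j' = (if Joint (next_index j) = q then next_index (next_index j) else next_index j)"
      have j': "j' \<in> {1, 2, 3}" "Joint j' \<notin> A"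
        using j q by (auto simp: j'_def split: if_splits)
      then obtain l where l: "l \<in> dowling_lines S R" "insert (Joint j') A \<subseteq> l"
        using neg by blast
      then show ?thesis
        using True by (auto simp: dowling_lines_eq relator_line_def)
    qed
    obtain i1 where i1: "i1 \<in> {1, 2, 3}" "insert (Joint 1) A \<subseteq> joint_line S i1"
      using on_line[of 1] by auto
    obtain i2 where i2: "i2 \<in> {1, 2, 3}" "insert (Joint 2) A \<subseteq> joint_line S i2"
      using on_line[of 2] by auto
    obtain i3 where i3: "i3 \<in> {1, 2, 3}" "insert (Joint 3) A \<subseteq> joint_line S i3"
      using on_line[of 3] by auto
    \<comment> \<open>The three lines share the two points of \<open>A\<close>, so they coincide,
      but a joint line has only two joints.\<close>
    have "i2 = i1" "i3 = i1"
      using two_joint_lines_meet_once[OF i2(1) i1(1) yz(2), of S]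
        two_joint_lines_meet_once[OF i3(1) i1(1) yz(2), of S] i1(2) i2(2) i3(2)
      by (simp_all add: yz(1))
    then have "Joint 1 \<in> joint_line S i1" "Joint 2 \<in> joint_line S i1" "Joint 3 \<in> joint_line S i1"
      using i1(2) i2(2) i3(2) by simp_all
    then show False using i1(1) by (auto simp: joint_line_def)
  qed
  then obtain j :: nat where j: "j \<in> {1, 2, 3}" "Joint j \<notin> A"
      "\<forall>l\<in>dowling_lines S R. \<not> insert (Joint j) A \<subseteq> l" by blast
  then have "dowling_indep S R (insert (Joint j) A)"
    using A True by (auto simp: dowling_indep_def dowling_ground_def)
  then show ?thesis using j(2) by blast
qed

text \<open>A joint in \<open>A\<close> would push the other two points onto the opposite joint
  line. So all points are group elements, and no two share an index, which leaves one point for each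
  of the indices 1, 2, 3.\<close>

lemma three_points_without_joint_line:
  assumes A: "A \<subseteq> dowling_ground S" "card A = 3"
    and no_line: "\<And>i y z. i \<in> {1, 2, 3} \<Longrightarrow> y \<in> A \<Longrightarrow> z \<in> A \<Longrightarrow> y \<in> joint_line S i \<Longrightarrow>
      z \<in> joint_line S i \<Longrightarrow> y = z"
  shows "\<exists>s s' s''. s \<in> S \<and> s' \<in> S \<and> s'' \<in> S \<and> A = relator_line s s' s'' 1"
proof -
  have fin: "finite A" using A(2) card.infinite by fastforce
  have no_joint: "Joint i \<notin> A" for i
  proof
    assume J: "Joint i \<in> A"
    then have i: "i \<in> {1, 2, 3}" using A(1) by (auto simp: dowling_ground_def)
    \<comment> \<open>\<open>Joint i\<close> lies on two joint lines. The other points of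
      \<open>A\<close> avoid both, and only the third line remains.\<close>
    have "A - {Joint i} \<subseteq> joint_line S (next_index i)"
    proof
      fix y assume y: "y \<in> A - {Joint i}"
      then consider (Joint) j where "j \<in> {1, 2, 3}" "y = Joint j" "j \<noteq> i"
        | (Elt) s j where "s \<in> S" "j \<in> {1, 2, 3}" "y = Elt s j"
        using A(1) dowling_ground_cases[of y S] by blast
      moreover have "y \<notin> joint_line S i"
        using no_line[OF i, of y "Joint i"] J y by (auto simp: joint_line_def)
      moreover have "Joint i \<in> joint_line S (next_index (next_index i))"
        using i by (auto simp: joint_line_def)
      then have "y \<notin> joint_line S (next_index (next_index i))"
        using no_line[of "next_index (next_index i)" y "Joint i"] J y i by auto
      ultimately show "y \<in> joint_line S (next_index i)"
        using i by cases (auto simp: joint_line_def)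
    qed
    moreover have "card (A - {Joint i}) = 2" using A(2) J fin by simp
    then obtain y z where "A - {Joint i} = {y, z}" "y \<noteq> z" by (auto simp: card_2_iff)
    moreover have "next_index i \<in> {1, 2, 3}" using i by auto
    ultimately show False using no_line[of "next_index i" y z] by blast
  qed
  \<comment> \<open>The value at joints is a filler, as \<open>A\<close> contains none.\<close>
  define idx where "idx x = (case x of Elt s i \<Rightarrow> i | Joint i \<Rightarrow> i)" for x :: "'a dowling_point"
  have elt: "\<exists>s i. s \<in> S \<and> i \<in> {1, 2, 3} \<and> x = Elt s i" if "x \<in> A" for x
    using that A(1) no_joint dowling_ground_cases[of x S] by blast
  have "inj_on idx A"
  proof (rule inj_onI)
    fix x y assume xy: "x \<in> A" "y \<in> A" "idx x = idx y"
    then obtain s i t where "s \<in> S" "t \<in> S" "i \<in> {1, 2, 3}" "x = Elt s i" "y = Elt t i"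
      using elt[of x] elt[of y] by (auto simp: idx_def)
    then show "x = y"
      using no_line[of i x y] xy by (auto simp: joint_line_def)
  qed
  moreover have "idx ` A \<subseteq> {1, 2, 3}"
  proof (rule image_subsetI)
    fix x assume "x \<in> A"
    from elt[OF this] show "idx x \<in> {1, 2, 3}" by (auto simp: idx_def)
  qed
  ultimately have surj: "idx ` A = {1, 2, 3}"
    using A(2) by (intro card_subset_eq) (auto simp: card_image)
  have get: "\<exists>s\<in>S. Elt s i \<in> A" if "i \<in> {1, 2, 3}" for i
  proof -
    have "i \<in> idx ` A" unfolding surj by (rule that)
    then obtain x where "x \<in> A" "idx x = i" by auto
    then show ?thesis using elt[of x] by (auto simp: idx_def)
  qed
  obtain s s' s'' where s: "s \<in> S" "s' \<in> S" "s'' \<in> S" "Elt s 1 \<in> A" "Elt s' 2 \<in> A" "Elt s'' 3 \<in> A"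
    using get[of 1] get[of 2] get[of 3] by auto
  have "relator_line s s' s'' 1 = A"
    using s A(2) by (intro card_subset_eq[OF fin]) (auto simp: relator_line_def)
  then show ?thesis using s by blast
qed

section \<open>The representation\<close>

text \<open>The real number \<open>k\<close> plays the role of \<open>c\<epsilon>\<close>.\<close>

locale approximate_action = finite_dimensional_vector_space scale Basis
  for scale :: "'a::field \<Rightarrow> 'b::ab_group_add \<Rightarrow> 'b" (infixr \<open>*s\<close> 75) and Basis :: "'b set" +
  fixes S :: "'s set" and R :: "'s list set" and \<rho> :: "'s \<Rightarrow> 'b \<Rightarrow> 'b" and k :: real
  assumes linear_rho: "\<And>s. Vector_Spaces.linear scale scale (\<rho> s)"
    and inj_rho: "\<And>s. s \<in> S \<Longrightarrow> inj (\<rho> s)"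
    and relator_rotate: "\<And>s s' s''. [s'', s', s] \<in> R \<Longrightarrow> [s', s, s''] \<in> R"
    and k_nonneg: "k \<ge> 0"
    and dim_coincidence: "\<And>s s'. s \<in> S \<Longrightarrow> s' \<in> S \<Longrightarrow> s \<noteq> s' \<Longrightarrow>
      real (dim {w. \<rho> s w = \<rho> s' w}) \<le> k"
    and dim_fixed: "\<And>s s' s''. s \<in> S \<Longrightarrow> s' \<in> S \<Longrightarrow> s'' \<in> S \<Longrightarrow> [s'', s', s] \<notin> R \<Longrightarrow>
      real (dim {w. \<rho> s'' (\<rho> s' (\<rho> s w)) = w}) \<le> k"
    and dim_moved: "\<And>s s' s''. [s'', s', s] \<in> R \<Longrightarrow>
      real (dim (range (\<lambda>w. w - \<rho> s'' (\<rho> s' (\<rho> s w))))) \<le> k"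
begin

section \<open>The point maps on the threefold sum of \<open>W\<close>\<close>

sublocale W2: finite_dimensional_vector_space_prod scale scale Basis Basis
  by unfold_locales

sublocale W3: finite_dimensional_vector_space_prod scale W2.scale Basis W2.Basis_pair
  by unfold_locales

sublocale W3_W: finite_dimensional_vector_space_pair W3.scale W3.Basis_pair scale Basis
  by unfold_locales

sublocale rho: Vector_Spaces.linear scale scale "\<rho> s" for s
  by (rule linear_rho)

text \<open>Every index other than 1 and 2 gives the third coordinate, so \<open>coord i\<close> is
  linear for all natural numbers \<open>i\<close>.\<close>

definition coord :: "nat \<Rightarrow> 'b \<times> 'b \<times> 'b \<Rightarrow> 'b" where
  "coord i v = (if i = 1 then fst v else if i = 2 then fst (snd v) else snd (snd v))"

fun point_map :: "'s dowling_point \<Rightarrow> 'b \<times> 'b \<times> 'b \<Rightarrow> 'b" where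
  "point_map (Joint i) v = coord i v"
| "point_map (Elt s i) v = coord (next_index i) v - \<rho> s (coord i v)"

definition kernel :: "'s dowling_point set \<Rightarrow> ('b \<times> 'b \<times> 'b) set" where
  "kernel A = {v. \<forall>x\<in>A. point_map x v = 0}"

lemma rho_eq_0_iff: "s \<in> S \<Longrightarrow> \<rho> s w = 0 \<longleftrightarrow> w = 0"
  using inj_eq[OF inj_rho, of s w 0] by simp

lemma linear_coord: "Vector_Spaces.linear W3.scale scale (coord i)"
  unfolding Vector_Spaces.linear_iff
  using W3.p.vector_space_axioms vector_space_axioms
  by (auto simp: coord_def W3.scale_def W2.scale_def)

sublocale coord: Vector_Spaces.linear W3.scale scale "coord i" for i
  by (rule linear_coord)

lemma linear_point_map: "Vector_Spaces.linear W3.scale scale (point_map x)"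
  unfolding Vector_Spaces.linear_iff
  using W3.p.vector_space_axioms vector_space_axioms
  by (cases x) (auto simp: coord.add coord.scale rho.add rho.scale scale_right_diff_distrib)

sublocale point_map: Vector_Spaces.linear W3.scale scale "point_map x" for x
  by (rule linear_point_map)

lemma subspace_kernel: "W3.p.subspace (kernel A)"
  unfolding W3.p.subspace_def kernel_def by (auto simp: point_map.add point_map.scale)

lemma surj_point_map:
  assumes "x \<in> dowling_ground S"
  shows "surj (point_map x)"
proof (rule surjI)
  fix w
  \<comment> \<open>The preimage of \<open>w\<close> is supported on the coordinate that enters the
    point map without \<open>\<rho>\<close>.\<close>
  let ?i = "case x of Joint i \<Rightarrow> i | Elt s i \<Rightarrow> next_index i"
  show "point_map x (if ?i = 1 then w else 0, if ?i = 2 then w else 0, if ?i = 3 then w else 0) = w"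
    using dowling_ground_cases[OF assms] by (auto simp: coord_def)
qed

lemma card_W3_Basis: "card W3.Basis_pair = 3 * card Basis"
  using W3.dimension_pair W2.dimension_pair
  by (simp add: W3.p.dimension_def W2.p.dimension_def dimension_def)

lemma coords_eq_0:
  assumes "i \<in> {1, 2, 3}"
    and "coord i v = 0" "coord (next_index i) v = 0" "coord (next_index (next_index i)) v = 0"
  shows "v = 0"
  using assms by (cases v) (auto simp: coord_def zero_prod_def)

section \<open>Kernels of independent sets\<close>

text \<open>For two group elements, subtracting the equations puts \<open>coord i v\<close> into the
  coincidence space of \<open>\<rho> s\<close> and \<open>\<rho> s'\<close>, and
  \<open>F = \<rho> s\<close>. Any other pair contains a joint, and injectivity of
  \<open>\<rho>\<close> makes both coordinates vanish.\<close>

lemma pair_on_joint_line: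
  assumes yz: "y \<in> joint_line S i" "z \<in> joint_line S i" "y \<noteq> z"
  obtains F N where "Vector_Spaces.linear scale scale F" "real (dim N) \<le> k"
    "\<forall>v\<in>kernel {y, z}. coord i v \<in> N \<and> coord (next_index i) v = F (coord i v)"
proof (cases "\<exists>s s'. s \<in> S \<and> s' \<in> S \<and> y = Elt s i \<and> z = Elt s' i")
  case True
  then obtain s s' where s: "s \<in> S" "s' \<in> S" "y = Elt s i" "z = Elt s' i" by blast
  show ?thesis
  proof (rule that[of "\<rho> s" "{w. \<rho> s w = \<rho> s' w}"])
    show "real (dim {w. \<rho> s w = \<rho> s' w}) \<le> k"
      using s yz(3) by (intro dim_coincidence) auto
  qed (use s linear_rho in \<open>auto simp: kernel_def\<close>)
next
  case False
  show ?thesis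
  proof (rule that[of "\<lambda>_. 0" "{0}"])
    show "Vector_Spaces.linear scale scale (\<lambda>_. 0)"
      by (rule W2.linear_zero)
    show "real (dim {0}) \<le> k" using k_nonneg by simp
    show "\<forall>v\<in>kernel {y, z}. coord i v \<in> {0} \<and> coord (next_index i) v = 0"
      using False yz by (auto simp: kernel_def joint_line_def rho_eq_0_iff)
  qed
qed

lemma dim_kernel_le_of_coord:
  assumes N: "real (dim N) \<le> k"
    and mem: "\<And>v. v \<in> kernel A \<Longrightarrow> coord i v \<in> N"
    and inj: "\<And>v. v \<in> kernel A \<Longrightarrow> coord i v = 0 \<Longrightarrow> v = 0"
  shows "real (W3.p.dim (kernel A)) \<le> k"
proof -
  have "inj_on (coord i) (kernel A)"
    using coord.inj_on_iff_eq_0[OF subspace_kernel] inj by blast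
  then have "W3.p.dim (kernel A) = dim (coord i ` kernel A)"
    using W3_W.dim_image_eq[OF linear_coord] W3.p.span_eq_iff subspace_kernel by metis
  also have "\<dots> \<le> dim N"
    using mem by (intro dim_subset) auto
  finally show ?thesis using N by linarith
qed

text \<open>Either two points share a joint line and the third lies off it, or the points are
  \<open>s\<close>, \<open>s'\<close>, \<open>s''\<close> with indices 1, 2, 3 that form no relator.
  In both cases one coordinate embeds the kernel into a space of dimension at most
  \<open>k\<close>.\<close>

lemma dim_kernel_independent_triple:
  assumes A: "A \<subseteq> dowling_ground S" "card A = 3"
    and not_line: "\<And>l. l \<in> dowling_lines S R \<Longrightarrow> \<not> A \<subseteq> l"
  shows "real (W3.p.dim (kernel A)) \<le> k"
proof (cases "\<exists>i\<in>{1, 2, 3}. \<exists>y\<in>A. \<exists>z\<in>A. y \<noteq> z \<and> y \<in> joint_line S i \<and> z \<in> joint_line S i")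
  case True
  then obtain i y z where i: "i \<in> {1, 2, 3}"
    and yz: "y \<in> A" "z \<in> A" "y \<noteq> z" "y \<in> joint_line S i" "z \<in> joint_line S i" by blast
  have "\<not> A \<subseteq> joint_line S i"
    using i by (intro not_line) (auto simp: dowling_lines_eq)
  then obtain x where x: "x \<in> A" "x \<notin> joint_line S i" by blast
  obtain F N where F: "Vector_Spaces.linear scale scale F" and N: "real (dim N) \<le> k"
    and NF: "\<forall>v\<in>kernel {y, z}. coord i v \<in> N \<and> coord (next_index i) v = F (coord i v)"
    by (rule pair_on_joint_line[OF yz(4,5,3)])
  interpret F: Vector_Spaces.linear scale scale F by (rule F)
  have NF: "coord i v \<in> N" "coord (next_index i) v = F (coord i v)" if "v \<in> kernel A" for v
    using bspec[OF NF, of v] that yz(1,2) by (auto simp: kernel_def)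
  show ?thesis
  proof (rule dim_kernel_le_of_coord[OF N NF(1)])
    fix v assume v: "v \<in> kernel A" "coord i v = 0"
    then have step: "coord (next_index i) v = 0" using NF(2) by simp
    have xv: "point_map x v = 0" using v(1) x(1) by (simp add: kernel_def)
    have n3: "next_index (next_index (next_index i)) = i" using i by auto
    have "x \<in> dowling_ground S" using x(1) A(1) by blast
    from dowling_ground_cases[OF this]
    \<comment> \<open>These are the points off line \<open>i\<close>. Each ties the remaining
      coordinate to 0 or to one already known to vanish, in the last case through injectivity of
      \<open>\<rho> s\<close>.\<close>
    have "x = Joint (next_index (next_index i)) \<or> (\<exists>s\<in>S. x = Elt s (next_index i)) \<or>
        (\<exists>s\<in>S. x = Elt s (next_index (next_index i)))"
      using x(2) i by (auto simp: joint_line_def)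
    then have "coord (next_index (next_index i)) v = 0"
      using xv v(2) step by (auto simp: rho_eq_0_iff n3)
    with v(2) step show "v = 0" by (rule coords_eq_0[OF i])
  qed
next
  case False
  then obtain s s' s'' where s: "s \<in> S" "s' \<in> S" "s'' \<in> S" "A = relator_line s s' s'' 1"
    using three_points_without_joint_line[OF A] by blast
  have "[s'', s', s] \<notin> R"
    using not_line[of A] s(4) by (auto simp: dowling_lines_eq)
  then have N: "real (dim {w. \<rho> s'' (\<rho> s' (\<rho> s w)) = w}) \<le> k"
    by (rule dim_fixed[OF s(1-3)])
  have eq2: "coord 2 v = \<rho> s (coord 1 v)" and eq3: "coord 3 v = \<rho> s' (coord 2 v)"
    and eq1: "\<rho> s'' (coord 3 v) = coord 1 v" if "v \<in> kernel A" for v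
  proof -
    have zero: "point_map x v = 0" if "x \<in> A" for x
      using \<open>v \<in> kernel A\<close> that unfolding kernel_def by blast
    have "Elt s 1 \<in> A" "Elt s' 2 \<in> A" "Elt s'' 3 \<in> A"
      unfolding s(4) relator_line_def by simp_all
    note zeros = this[THEN zero]
    show "coord 2 v = \<rho> s (coord 1 v)" using zeros(1) by simp
    show "coord 3 v = \<rho> s' (coord 2 v)" using zeros(2) by simp
    show "\<rho> s'' (coord 3 v) = coord 1 v" using zeros(3) by simp
  qed
  show ?thesis
  proof (rule dim_kernel_le_of_coord[OF N, of A 1])
    show "coord 1 v \<in> {w. \<rho> s'' (\<rho> s' (\<rho> s w)) = w}" if "v \<in> kernel A" for v
      using eq1[OF that] unfolding eq3[OF that] eq2[OF that] by simp
    show "v = 0" if "v \<in> kernel A" "coord 1 v = 0" for v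
    proof -
      have "coord 2 v = 0" using eq2[OF that(1)] that(2) by simp
      moreover have "coord 3 v = 0" using eq3[OF that(1)] calculation by simp
      ultimately show ?thesis using that(2) by (intro coords_eq_0[of 1]) simp_all
    qed
  qed
qed

text \<open>Downward induction from triples: dropping a point \<open>x\<close> enlarges the kernel
  by at most the dimension \<open>card Basis\<close> of the target of
  \<open>point_map x\<close>.\<close>

lemma dim_kernel_independent:
  assumes "dowling_indep S R A"
  shows "real (W3.p.dim (kernel A)) \<le> (3 - real (card A)) * real (card Basis) + k"
  using assms
proof (induction "3 - card A" arbitrary: A)
  case 0
  then have "card A = 3" by (auto simp: dowling_indep_def)
  then show ?case
    using dim_kernel_independent_triple[of A] "0.prems" by (auto simp: dowling_indep_def)
next
  case (Suc n)
  then have card: "card A < 3" by simp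
  obtain x where x: "x \<notin> A" "dowling_indep S R (insert x A)"
    using dowling_indep_extend[OF Suc.prems card] by blast
  have fin: "finite A" using Suc.prems by (simp add: dowling_indep_def)
  have "W3.p.dim (kernel A) \<le> dim (point_map x ` kernel A) + W3.p.dim {v \<in> kernel A. point_map x v = 0}"
    by (rule W3_W.dim_le_image_plus_kernel[OF linear_point_map subspace_kernel])
  moreover have "{v \<in> kernel A. point_map x v = 0} = kernel (insert x A)"
    by (auto simp: kernel_def)
  moreover have "dim (point_map x ` kernel A) \<le> card Basis"
    using dim_subset[OF subset_UNIV] by simp
  moreover have "real (W3.p.dim (kernel (insert x A)))
      \<le> (3 - real (card (insert x A))) * real (card Basis) + k"
    using x fin Suc.hyps(2) by (intro Suc.hyps(1)) auto
  ultimately show ?case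
    using x(1) fin by (simp add: algebra_simps)
qed

section \<open>Circuits\<close>

text \<open>On a joint line, the kernel of two points sees \<open>point_map x\<close> as a linear
  function of one coordinate confined to a small space. On a relator line, elimination leaves
  \<open>w\<close> minus its image under the triple product.\<close>

lemma dim_image_collinear:
  assumes l: "l \<in> dowling_lines S R" and C: "card C = 3" "C \<subseteq> l" "x \<in> C"
  shows "real (dim (point_map x ` kernel (C - {x}))) \<le> k"
proof -
  consider (joint) i where "i \<in> {1, 2, 3}" "l = joint_line S i"
    | (relator) s s' s'' i where "[s'', s', s] \<in> R" "i \<in> {1, 2, 3}" "l = relator_line s s' s'' i"
    using l unfolding dowling_lines_eq by (elim UnE imageE CollectE exE conjE) metis+
  then show ?thesis
  proof cases
    case joint
    have "card (C - {x}) = 2" using C by simp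
    then obtain y z where yz: "C - {x} = {y, z}" "y \<noteq> z" by (auto simp: card_2_iff)
    then have yz_line: "y \<in> joint_line S i" "z \<in> joint_line S i" using C(2) joint(2) by auto
    obtain F N where F: "Vector_Spaces.linear scale scale F" and N: "real (dim N) \<le> k"
      and NF: "\<forall>v\<in>kernel {y, z}. coord i v \<in> N \<and> coord (next_index i) v = F (coord i v)"
      by (rule pair_on_joint_line[OF yz_line yz(2)])
    \<comment> \<open>Depending on \<open>x\<close>, the map \<open>H\<close> is the identity,
      \<open>F\<close>, or \<open>F\<close> minus some \<open>\<rho> s\<close>.\<close>
    have "\<exists>H. Vector_Spaces.linear scale scale H \<and>
        (\<forall>v\<in>kernel {y, z}. point_map x v = H (coord i v))"
    proof -
      have "x \<in> joint_line S i" using C joint(2) by auto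
      then consider "x = Joint i" | "x = Joint (next_index i)" | s where "x = Elt s i"
        by (auto simp: joint_line_def)
      then show ?thesis
      proof cases
        case 1
        then show ?thesis using linear_ident by (intro exI[of _ "\<lambda>w. w"]) simp
      next
        case 2
        then show ?thesis using F NF by (intro exI[of _ F]) simp
      next
        case (3 s)
        then show ?thesis using NF W2.linear_compose_sub[OF F linear_rho[of s]]
          by (intro exI[of _ "\<lambda>w. F w - \<rho> s w"]) simp
      qed
    qed
    then obtain H where H: "Vector_Spaces.linear scale scale H"
      "\<And>v. v \<in> kernel {y, z} \<Longrightarrow> point_map x v = H (coord i v)" by blast
    have "point_map x ` kernel {y, z} \<subseteq> H ` N"
      using H(2) NF by auto
    then have "dim (point_map x ` kernel {y, z}) \<le> dim N"
      by (rule W2.dim_le_of_subset_image[OF H(1)])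
    then show ?thesis using N yz(1) by simp
  next
    case relator
    have "finite l" "card l \<le> card C"
      using C(1) unfolding relator(3) relator_line_def
      by (auto simp: card_insert_if)
    then have Cl: "C = l" using C(2) by (metis card_seteq)
    \<comment> \<open>By the cyclic symmetry of relators and indices, the removed point may be taken
      as the last one on the line.\<close>
    have "\<exists>s s' s'' i. [s'', s', s] \<in> R \<and> i \<in> {1, 2, 3} \<and> C = relator_line s s' s'' i \<and>
        x = Elt s'' (next_index (next_index i))"
    proof -
      note rot = relator_rotate[OF relator(1)]
      have n: "next_index i \<in> {1, 2, 3}" "next_index (next_index i) \<in> {1, 2, 3}"
          "next_index (next_index (next_index i)) = i"
        using relator(2) by auto
      have shift: "C = relator_line s' s'' s (next_index i)"
          "C = relator_line s'' s s' (next_index (next_index i))"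
        unfolding Cl relator(3) relator_line_def n(3) by blast+
      consider "x = Elt s i" | "x = Elt s' (next_index i)" | "x = Elt s'' (next_index (next_index i))"
        using C(3) unfolding Cl relator(3) relator_line_def by blast
      then show ?thesis
      proof cases
        case 1
        then have "[s, s'', s'] \<in> R \<and> next_index i \<in> {1, 2, 3} \<and>
            C = relator_line s' s'' s (next_index i) \<and>
            x = Elt s (next_index (next_index (next_index i)))"
          using relator_rotate[OF rot] n shift by simp
        then show ?thesis by blast
      next
        case 2
        then have "[s', s, s''] \<in> R \<and> next_index (next_index i) \<in> {1, 2, 3} \<and>
            C = relator_line s'' s s' (next_index (next_index i)) \<and>
            x = Elt s' (next_index (next_index (next_index (next_index i))))"
          using rot n shift by simp
        then show ?thesis by blast
      next
        case 3
        then show ?thesis using relator Cl by blast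
      qed
    qed
    then obtain s s' s'' i where s: "[s'', s', s] \<in> R" "i \<in> {1, 2, 3}" "C = relator_line s s' s'' i"
      "x = Elt s'' (next_index (next_index i))" by blast
    have n: "next_index (next_index (next_index i)) = i" "i \<noteq> next_index i"
        "i \<noteq> next_index (next_index i)" "next_index i \<noteq> next_index (next_index i)"
      using s(2) by auto
    have Cx: "C - {x} = {Elt s i, Elt s' (next_index i)}"
      using n unfolding s(3,4) relator_line_def by auto
    have "point_map x ` kernel (C - {x}) \<subseteq> range (\<lambda>w. w - \<rho> s'' (\<rho> s' (\<rho> s w)))"
    proof (rule image_subsetI)
      fix v assume "v \<in> kernel (C - {x})"
      then have "coord (next_index i) v = \<rho> s (coord i v)"
          "coord (next_index (next_index i)) v = \<rho> s' (coord (next_index i) v)"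
        by (simp_all add: Cx kernel_def)
      then have "point_map x v = coord i v - \<rho> s'' (\<rho> s' (\<rho> s (coord i v)))"
        by (simp add: s(4) n(1))
      then show "point_map x v \<in> range (\<lambda>w. w - \<rho> s'' (\<rho> s' (\<rho> s w)))" by blast
    qed
    then have "dim (point_map x ` kernel (C - {x})) \<le> dim (range (\<lambda>w. w - \<rho> s'' (\<rho> s' (\<rho> s w))))"
      by (rule dim_subset)
    then show ?thesis using dim_moved[OF s(1)] by linarith
  qed
qed

text \<open>Circuits have three or four points. Three are collinear; with four,
  \<open>C - {x}\<close> is an independent triple whose whole kernel already has dimension at most
  \<open>k\<close>.\<close>

lemma dim_image_circuit:
  assumes C: "circuit (dowling_ground S) (dowling_indep S R) C" and x: "x \<in> C"
  shows "real (dim (point_map x ` kernel (C - {x}))) \<le> k"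
proof -
  have indep: "dowling_indep S R (C - {x})"
    using C x unfolding circuit_def by blast
  then have fin: "finite C" by (simp add: dowling_indep_def)
  have sub: "C \<subseteq> dowling_ground S" and dep: "\<not> dowling_indep S R C"
    using C by (auto simp: circuit_def)
  have card: "card C = Suc (card (C - {x}))"
    using card_Suc_Diff1[OF fin x] by simp
  have "card (C - {x}) \<le> 3" using indep by (auto simp: dowling_indep_def)
  moreover have "card C > 2" using dep sub fin by (auto simp: dowling_indep_def)
  ultimately consider "card C = 3" | "card (C - {x}) = 3" using card by linarith
  then show ?thesis
  proof cases
    case 1
    then obtain l where "l \<in> dowling_lines S R" "C \<subseteq> l"
      using dep sub fin by (auto simp: dowling_indep_def)
    then show ?thesis using dim_image_collinear 1 x by blast
  next
    case 2
    have "dim (point_map x ` kernel (C - {x})) \<le> W3.p.dim (kernel (C - {x}))"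
      by (rule W3_W.dim_image_le[OF linear_point_map])
    then show ?thesis using dim_kernel_independent[OF indep] 2 by simp
  qed
qed

lemma has_approx_representation_dowling:
  assumes "card Basis > 0" and k: "k = real (card Basis) * \<epsilon>"
  shows "has_approx_representation TYPE('a) (dowling_ground S) (dowling_indep S R) \<epsilon>"
proof (rule has_approx_representationI[where T = point_map])
  show "finite_dimensional_vector_space W3.scale W3.Basis_pair" by unfold_locales
  show "finite_dimensional_vector_space scale Basis" by unfold_locales
  show "real (W3.p.dim {v. \<forall>x\<in>A. point_map x v = 0})
      \<le> real (card W3.Basis_pair) - real (card Basis) * (real (card A) - \<epsilon>)"
    if "dowling_indep S R A" for A
    using dim_kernel_independent[OF that]
    by (simp add: kernel_def card_W3_Basis k algebra_simps)
  show "real (dim (point_map x ` {v. \<forall>y\<in>C - {x}. point_map y v = 0})) \<le> real (card Basis) * \<epsilon>"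
    if "circuit (dowling_ground S) (dowling_indep S R) C" "x \<in> C" for C x
    using dim_image_circuit[OF that] by (simp add: kernel_def k)
qed (use assms linear_point_map surj_point_map in auto)

end

section \<open>From the hypotheses on the group to the representation\<close>

text \<open>This converse of (d) makes (c), which speaks of identities in the group, available for
  relators.\<close>

lemma tri_group_relator:
  assumes "[s'', s', s] \<in> R" and S: "s \<in> S" "s' \<in> S" "s'' \<in> S"
  shows "tri_gen S R e s'' \<otimes>\<^bsub>tri_group S R e\<^esub> tri_gen S R e s' \<otimes>\<^bsub>tri_group S R e\<^esub> tri_gen S R e s
    = \<one>\<^bsub>tri_group S R e\<^esub>"
proof -
  let ?R = "tri_relators R e" and ?w = "[(s'', True), (s', True), (s, True)]"
  have "positive_word [s'', s', s] \<in> ?R"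
    using assms(1) unfolding tri_relators_def by blast
  then have "word_equiv S ?R ([] @ ?w @ []) ([] @ [])"
    using S by (intro word_equiv.relator) (auto simp: positive_word_def)
  then have "word_rel S ?R `` {?w} = word_rel S ?R `` {[]}"
    by (intro equiv_class_eq[OF equiv_word_rel]) (simp add: word_rel_def)
  then show ?thesis
    using S
    by (simp add: tri_group_def tri_gen_def presented_gen_def presented_group_mult)
      (simp add: presented_group_def)
qed

text \<open>Covers the case of zero \<open>W\<close>. Every generator acts as the identity on the
  field, so \<open>c = 1\<close>: if \<open>S = {e}\<close>, there are no distinct generators and
  the only triple is the relator \<open>eee\<close>; otherwise \<open>\<epsilon> \<ge> 1\<close>
  bounds every dimension.\<close>

lemma dowling_trivial_representation:
  fixes S :: "'s set" and R :: "'s list set" and e :: 's and \<epsilon> :: real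
  assumes pres: "symmetric_triangular S R e sinv"
    and eps: "\<epsilon> \<ge> 0" and dichotomy: "S = {e} \<or> \<epsilon> \<ge> 1"
  shows "has_approx_representation TYPE('f::field) (dowling_ground S) (dowling_indep S R) \<epsilon>"
proof -
  interpret symmetric_triangular S R e sinv by (rule pres)
  interpret F: finite_dimensional_vector_space "(*) :: 'f \<Rightarrow> 'f \<Rightarrow> 'f" "{1}"
    by (rule finite_dimensional_vector_space_field)
  have dim_le: "\<epsilon> \<ge> 1 \<Longrightarrow> real (F.dim X) \<le> \<epsilon>" for X
    using F.dim_subset_UNIV[of X] by (simp add: F.dimension_def)
  have "approximate_action (*) {1 :: 'f} S R (\<lambda>_ w. w) \<epsilon>"
  proof unfold_locales
    show "[s', s, s''] \<in> R" if "[s'', s', s] \<in> R" for s s' s''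
      using that by (rule relator_rotate1)
    show "real (F.dim {w :: 'f. w = w}) \<le> \<epsilon>" if "s \<in> S" "s' \<in> S" "s \<noteq> s'" for s s'
      using that dichotomy dim_le by auto
    show "real (F.dim {w :: 'f. w = w}) \<le> \<epsilon>"
      if "s \<in> S" "s' \<in> S" "s'' \<in> S" "[s'', s', s] \<notin> R" for s s' s''
      using that dichotomy dim_le eee_relator by auto
    show "real (F.dim (range (\<lambda>w :: 'f. w - w))) \<le> \<epsilon>" for s s' s'' :: 's
      using eps by simp
  qed (use eps in \<open>auto simp: algebra_simps\<close>)
  then interpret approximate_action "(*)" "{1 :: 'f}" S R "\<lambda>_ w. w" \<epsilon> .
  show ?thesis
    by (rule has_approx_representation_dowling) auto
qed

theorem theorem9p8:
  fixes S :: "'s set" and R :: "'s list set" and e :: 's and sinv :: "'s \<Rightarrow> 's"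
    and scale :: "'f::field \<Rightarrow> 'w::ab_group_add \<Rightarrow> 'w" and Basis :: "'w set"
    and \<rho> :: "'s \<Rightarrow> 'w \<Rightarrow> 'w" and \<epsilon> :: real
    and G :: "('s \<times> bool) list set monoid" and g :: "'s \<Rightarrow> ('s \<times> bool) list set"
  defines "G \<equiv> tri_group S R e" and "g \<equiv> tri_gen S R e"
  assumes pres: "symmetric_triangular S R e sinv"
    and eps: "\<epsilon> \<ge> 0"
    and W: "finite_dimensional_vector_space scale Basis"
    and rho: "\<And>s. s \<in> S \<Longrightarrow> \<rho> s \<in> general_linear scale"
    and a: "\<And>s s'. s \<in> S \<Longrightarrow> s' \<in> S \<Longrightarrow> s \<noteq> s' \<Longrightarrow> d_rk scale (\<rho> s) (\<rho> s') \<ge> 1 - \<epsilon> / 18"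
    and b: "\<And>s s' s''. s \<in> S \<Longrightarrow> s' \<in> S \<Longrightarrow> s'' \<in> S \<Longrightarrow>
              g s'' \<otimes>\<^bsub>G\<^esub> g s' \<otimes>\<^bsub>G\<^esub> g s \<noteq> \<one>\<^bsub>G\<^esub> \<Longrightarrow>
              d_rk scale (\<rho> s'' \<circ> \<rho> s' \<circ> \<rho> s) id \<ge> 1 - \<epsilon> / 18"
    and c: "\<And>s s' s''. s \<in> S \<Longrightarrow> s' \<in> S \<Longrightarrow> s'' \<in> S \<Longrightarrow>
              g s'' \<otimes>\<^bsub>G\<^esub> g s' \<otimes>\<^bsub>G\<^esub> g s = \<one>\<^bsub>G\<^esub> \<Longrightarrow>
              d_rk scale (\<rho> s'' \<circ> \<rho> s' \<circ> \<rho> s) id \<le> \<epsilon> / 18"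
    and c_e: "d_rk scale (\<rho> e) id \<le> \<epsilon> / 18"
    and d: "\<And>s s' s''. s \<in> S \<Longrightarrow> s' \<in> S \<Longrightarrow> s'' \<in> S \<Longrightarrow>
              g s'' \<otimes>\<^bsub>G\<^esub> g s' \<otimes>\<^bsub>G\<^esub> g s = \<one>\<^bsub>G\<^esub> \<Longrightarrow> [s'', s', s] \<in> R"
  shows "has_approx_representation TYPE('f) (dowling_ground S) (dowling_indep S R) \<epsilon>"
proof -
  interpret symmetric_triangular S R e sinv by (rule pres)
  interpret W: finite_dimensional_vector_space scale Basis by (rule W)
  interpret WW: finite_dimensional_vector_space_pair_1 scale Basis scale by unfold_locales
  let ?c = "real (card Basis)"
  have in_S: "s \<in> S" "s' \<in> S" "s'' \<in> S" if "[s'', s', s] \<in> R" for s s' s''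
    using relator_words[OF that] by auto
  show ?thesis
  proof (cases "card Basis = 0")
    case True
    \<comment> \<open>Then \<open>d_rk\<close> is \<open>x / 0 = 0\<close>, and the hypotheses only say that \<open>\<epsilon>\<close> is large or \<open>S = {e}\<close>.\<close>
    have "S = {e} \<or> \<epsilon> \<ge> 1"
    proof (rule ccontr)
      assume "\<not> ?thesis"
      then obtain s where "s \<in> S" "s \<noteq> e" "\<epsilon> < 1" using e_in by auto
      then show False using a[of s e] e_in True by (simp add: d_rk_def)
    qed
    then show ?thesis by (rule dowling_trivial_representation[OF pres eps])
  next
    case False
    then have pos: "?c > 0" by simp
    \<comment> \<open>The locale asks for linearity at every \<open>s\<close>, so
      \<open>\<rho>\<close> is extended by the identity outside \<open>S\<close>.\<close>
    define \<rho>' where "\<rho>' s = (if s \<in> S then \<rho> s else (\<lambda>w. w))" for s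
    have lin': "Vector_Spaces.linear scale scale (\<rho>' s)" and bij': "bij (\<rho>' s)" for s
      using rho[of s] W.linear_ident by (auto simp: \<rho>'_def general_linear_def bij_betw_def)
    have lin3: "Vector_Spaces.linear scale scale (\<lambda>w. \<rho>' s'' (\<rho>' s' (\<rho>' s w)))" for s s' s''
      using Vector_Spaces.linear_compose[OF Vector_Spaces.linear_compose[OF lin'[of s] lin'[of s']] lin'[of s'']]
      by (simp add: comp_def)
    have slack: "?c * (\<epsilon> / 18) \<le> ?c * \<epsilon>"
      using eps by (intro mult_left_mono) auto
    \<comment> \<open>A rank of at least \<open>?c * (1 - \<epsilon> / 18)\<close> for the
      difference leaves at most \<open>?c * (\<epsilon> / 18)\<close> for its kernel. Taking
      \<open>h\<close> to be the identity gives the bound for fixed spaces.\<close>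
    have coincidence: "real (W.dim {w. f w = h w}) \<le> ?c * \<epsilon>"
      if "d_rk scale f h \<ge> 1 - \<epsilon> / 18"
        and "Vector_Spaces.linear scale scale f" "Vector_Spaces.linear scale scale h" for f h
    proof -
      have "W.dim (range (\<lambda>w. f w - h w)) + W.dim {w. f w - h w = 0} \<le> card Basis"
        using that by (intro WW.rank_plus_nullity_le WW.linear_compose_sub)
      moreover have "?c * (1 - \<epsilon> / 18) \<le> real (W.dim (range (\<lambda>w. f w - h w)))"
        using that(1) pos by (simp add: d_rk_def rk_def field_simps)
      ultimately show ?thesis using slack by (simp add: algebra_simps)
    qed
    have "approximate_action scale Basis S R \<rho>' (?c * \<epsilon>)"
    proof unfold_locales
      show "\<rho>' s (x + y) = \<rho>' s x + \<rho>' s y" "\<rho>' s (scale r x) = scale r (\<rho>' s x)" for s x y r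
        using lin'[of s] unfolding Vector_Spaces.linear_iff by blast+
      show "inj (\<rho>' s)" for s using bij' by (rule bij_is_inj)
      show "[s', s, s''] \<in> R" if "[s'', s', s] \<in> R" for s s' s''
        using that by (rule relator_rotate1)
      show "?c * \<epsilon> \<ge> 0" using eps by simp
      show "real (W.dim {w. \<rho>' s w = \<rho>' s' w}) \<le> ?c * \<epsilon>" if "s \<in> S" "s' \<in> S" "s \<noteq> s'" for s s'
        using coincidence[OF _ lin' lin', of s s'] a[OF that] that by (simp add: \<rho>'_def)
      show "real (W.dim {w. \<rho>' s'' (\<rho>' s' (\<rho>' s w)) = w}) \<le> ?c * \<epsilon>"
        if s: "s \<in> S" "s' \<in> S" "s'' \<in> S" and "[s'', s', s] \<notin> R" for s s' s''
      proof (rule coincidence[OF _ lin3 W.linear_ident])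
        \<comment> \<open>By contraposition of (d), a triple that is no relator is nontrivial in the
          group, so (b) applies.\<close>
        have "g s'' \<otimes>\<^bsub>G\<^esub> g s' \<otimes>\<^bsub>G\<^esub> g s \<noteq> \<one>\<^bsub>G\<^esub>"
          using d[OF s] that(4) by blast
        from b[OF s this]
        show "d_rk scale (\<lambda>w. \<rho>' s'' (\<rho>' s' (\<rho>' s w))) (\<lambda>w. w) \<ge> 1 - \<epsilon> / 18"
          using s by (simp add: \<rho>'_def d_rk_def)
      qed
      show "real (W.dim (range (\<lambda>w. w - \<rho>' s'' (\<rho>' s' (\<rho>' s w))))) \<le> ?c * \<epsilon>"
        if "[s'', s', s] \<in> R" for s s' s''
      proof -
        note s = in_S[OF that]
        have "g s'' \<otimes>\<^bsub>G\<^esub> g s' \<otimes>\<^bsub>G\<^esub> g s = \<one>\<^bsub>G\<^esub>"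
          using tri_group_relator[OF that s] by (simp add: G_def g_def)
        from c[OF s this]
        have "real (W.dim (range (\<lambda>w. \<rho>' s'' (\<rho>' s' (\<rho>' s w)) - w))) \<le> ?c * (\<epsilon> / 18)"
          using s pos by (simp add: \<rho>'_def d_rk_def rk_def field_simps)
        \<comment> \<open>The difference in \<open>d_rk\<close> has the opposite sign; negation
          carries one range onto the other.\<close>
        moreover have "W.dim (range (\<lambda>w. w - \<rho>' s'' (\<rho>' s' (\<rho>' s w))))
            \<le> W.dim (range (\<lambda>w. \<rho>' s'' (\<rho>' s' (\<rho>' s w)) - w))"
          by (rule WW.dim_le_of_subset_image[OF W.linear_uminus]) (force simp: image_image)
        ultimately show ?thesis using slack by linarith
      qed
    qed
    then interpret approximate_action scale Basis S R \<rho>' "?c * \<epsilon>" .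
    show ?thesis
      using False W.finite_Basis by (intro has_approx_representation_dowling) auto
  qed
qed

end
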